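(* Let $f:\mathbb{R}\to\mathbb{R}$ be locally Lipschitz continuous, increasing and odd, with $f(0)=0$ and $xf(x)>0$ for all $x\neq 0$. Suppose that there exists $\epsilon_0\in(0,1)$ such that for every $\epsilon\in(0,\epsilon_0)$ $$\underline{\Phi}_f(\epsilon):=\liminf_{x\to 0^+}\frac{f((1-\epsilon)x)}{f(x)}>0,\qquad\text{and}\quad \underline{\Phi}_f(\epsilon)\to 1\ \text{ as } \epsilon\to 0^+,$$ and that $$\limsup_{x\to 0^+}\frac{f(\mu x)}{f(x)}<\mu\quad\text{for all }\mu\in(0,1).$$ Let $g:[0,\infty)\to\mathbb{R}$ be continuous, let $\xi\in\mathbb{R}$, and let $x$ be the continuous solution on $[0,\infty)$ of $x'(t)=-f(x(t))+g(t)$, $t>0$, $x(0)=\xi$. Suppose that $x(t)\to 0$ as $t\to\infty$. Then the following statements are equivalent: (c) $$\lim_{t\to\infty}\frac{g(t)}{f(F^{-1}(t))}=0;$$ (d) there is $\lambda\in\{-1,0,1\}$ such that $$\lim_{t\to\infty}\frac{x(t)}{F^{-1}(t)}=\lambda,\qquad \lim_{t\to\infty}\frac{x'(t)}{f(F^{-1}(t))}=-\lambda.$$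
   Context: $F:(0,\infty)\to\mathbb{R}$ is defined by $F(x)=\int_x^1 \frac{1}{f(u)}\,du$. It is strictly decreasing, and $F^{-1}$ denotes its inverse function. Under the stated hypotheses $F(x)\to+\infty$ as $x\to0^+$, so $F^{-1}(t)$ is defined for all $t\ge 0$. *)

theory Defs
  imports "HOL-Analysis.Analysis"
begin

text \<open>The interval integral is oriented, so \<open>F_of f x\<close> is negative for \<open>x > 1\<close>
  (and \<open>f > 0\<close> on the positive axis). Only its values on \<open>{0<..}\<close> are meaningful.\<close>

definition F_of :: "(real \<Rightarrow> real) \<Rightarrow> real \<Rightarrow> real" where
  "F_of f x = (LBINT u = ereal x..ereal 1. 1 / f u)"

definition F_inv :: "(real \<Rightarrow> real) \<Rightarrow> real \<Rightarrow> real" where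
  "F_inv f = inv_into {0<..} (F_of f)"

text \<open>Extended-real valued, so that the limit inferior always exists.\<close>

definition lower_Phi :: "(real \<Rightarrow> real) \<Rightarrow> real \<Rightarrow> ereal" where
  "lower_Phi f \<epsilon> = Liminf (at_right 0) (\<lambda>x. ereal (f ((1 - \<epsilon>) * x) / f x))"

end

theory Submission
  imports Defs
begin

text \<open>
  Put \<open>y = F\<^sup>-\<^sup>1\<close>, so that \<open>y' = - f y\<close>, and suppose \<open>g = o(f y)\<close>. Since
  \<open>limsup f (\<mu> u) / f u < \<mu>\<close>, the ratio \<open>x / y\<close> can cross a level \<open>l \<notin> {-1, 0, 1}\<close> in one
  direction only at late times, so \<open>x - l y\<close> has an eventual sign. For \<open>l > 0\<close>, the function
  \<open>F (x / l)\<close>, compared with \<open>F y = t\<close>, has derivative about \<open>f x / (l f (x / l))\<close>, which is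
  bounded away from \<open>1\<close>: above if \<open>l > 1\<close> and below if \<open>l < 1\<close>. Hence \<open>x > l y\<close> cannot persist
  for \<open>l > 1\<close>, nor \<open>m y < x < l y\<close> for \<open>0 < m < l < 1\<close>. Together with the symmetry
  \<open>(x, g) \<mapsto> (- x, - g)\<close>, this leaves only the limits \<open>-1, 0, 1\<close> for \<open>x / y\<close>.
  The condition on \<open>lower_Phi\<close> gives \<open>f x / f y \<longrightarrow> \<Lambda>\<close> from \<open>x / y \<longrightarrow> \<Lambda>\<close>, which
  transfers between \<open>g\<close> and \<open>x'\<close> through the equation.
\<close>

section \<open>Eventual signs and linear growth of real functions\<close>

text \<open>Every late zero of \<open>v\<close> is an upward crossing. Once \<open>v\<close> is
  nonnegative it is therefore positive ever after, and otherwise it is negative at all late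
  times.\<close>

lemma eventually_sign_if_deriv_pos_at_zeros:
  fixes v v' :: "real \<Rightarrow> real"
  assumes deriv: "\<forall>\<^sub>F t in at_top. (v has_real_derivative v' t) (at t)"
    and pos: "\<forall>\<^sub>F t in at_top. v t = 0 \<longrightarrow> v' t > 0"
  shows "(\<forall>\<^sub>F t in at_top. v t > 0) \<or> (\<forall>\<^sub>F t in at_top. v t < 0)"
proof -
  obtain T where T: "\<And>t. t \<ge> T \<Longrightarrow> (v has_real_derivative v' t) (at t)"
      "\<And>t. t \<ge> T \<Longrightarrow> v t = 0 \<Longrightarrow> v' t > 0"
    using eventually_conj[OF deriv pos] unfolding eventually_at_top_linorder by metis
  have cont: "continuous_on {a..b} v" if "a \<ge> T" for a b
    by (rule DERIV_continuous_on, rule has_field_derivative_at_within, rule T(1)) (use that in auto)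
  have right: "\<exists>d>0. \<forall>h\<in>{0<..<d}. v (a + h) > 0" if a: "a \<ge> T" "v a = 0" for a
    using DERIV_pos_inc_right[OF T(1)[OF a(1)] T(2)[OF a]] a(2) by auto
  have up: "v b > 0" if ab: "T \<le> a" "a < b" "v a \<ge> 0" for a b
  proof (rule ccontr)
    assume nb: "\<not> v b > 0"
    \<comment> \<open>If \<open>v a = 0\<close>, the positive derivative makes \<open>v\<close>
      positive just to the right of \<open>a\<close>.\<close>
    have "\<exists>a'\<ge>a. a' < b \<and> v a' > 0"
    proof (cases "v a > 0")
      case False
      then obtain d where d: "d > 0" "\<forall>h\<in>{0<..<d}. v (a + h) > 0"
        using right[of a] ab by force
      define h where "h = min (d/2) ((b - a)/2)"
      have "h \<in> {0<..<d}" "h < b - a"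
        using d ab by (auto simp: h_def min_def)
      then show ?thesis using d by (intro exI[of _ "a + h"]) auto
    qed (use ab in auto)
    then obtain a' where a': "a' \<ge> a" "a' < b" "v a' > 0" by blast
    \<comment> \<open>The least element \<open>c\<close> of this compact set is the first time after
      \<open>a'\<close> at which \<open>v\<close> is not positive; continuity forces
      \<open>v c = 0\<close>.\<close>
    define S where "S = {s \<in> {a'..b}. v s \<in> {..0}}"
    have "closed S"
      unfolding S_def using cont[of a' b] a' ab
      by (intro continuous_closed_preimage[unfolded vimage_def Int_def, simplified]) auto
    moreover have "S \<subseteq> {a'..b}" by (auto simp: S_def)
    ultimately have "compact S"
      by (meson bounded_closed_interval bounded_subset compact_eq_bounded_closed)
    moreover have "b \<in> S" using nb a' by (auto simp: S_def)
    ultimately obtain c where c: "c \<in> S" "\<And>s. s \<in> S \<Longrightarrow> c \<le> s"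
      using compact_attains_inf[of S] by blast
    have before: "v s > 0" if "s \<in> {a'..<c}" for s
      using c that by (force simp: S_def)
    have ac: "a' < c" "c \<le> b" "v c \<le> 0"
      using c(1) a'(3) by (auto simp: S_def order_le_less)
    have "v c \<ge> 0"
    proof (rule ccontr)
      assume "\<not> v c \<ge> 0"
      then obtain s where "a' \<le> s" "s \<le> c" "v s = 0"
        using IVT2'[of v c 0 a'] cont[of a' c] a' ab ac by auto
      then show False using before[of s] \<open>\<not> v c \<ge> 0\<close> by (cases "s = c") auto
    qed
    with ac have vc: "v c = 0" by simp
    have Tc: "c \<ge> T" using ab a' ac by linarith
    \<comment> \<open>The positive derivative at \<open>c\<close> makes \<open>v\<close> negative
      just to the left of \<open>c\<close>, where minimality of \<open>c\<close> makes it
      positive.\<close>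
    obtain d where d: "d > 0" "\<forall>h>0. h < d \<longrightarrow> v (c - h) < v c"
      using DERIV_pos_inc_left[OF T(1)[OF Tc] T(2)[OF Tc vc]] by auto
    define h where "h = min (d/2) ((c - a')/2)"
    have "h > 0" "h < d" "a' \<le> c - h"
      using d ac by (auto simp: h_def min_def field_simps)
    then show False using d(2) before[of "c - h"] vc by force
  qed
  show ?thesis
  proof (cases "\<exists>a\<ge>T. v a \<ge> 0")
    case True
    then obtain a where "a \<ge> T" "v a \<ge> 0" by blast
    then have "\<forall>\<^sub>F t in at_top. v t > 0"
      using up[of a] by (intro eventually_mono[OF eventually_gt_at_top[of a]]) auto
    then show ?thesis by blast
  next
    case False
    then have "\<forall>\<^sub>F t in at_top. v t < 0"
      by (intro eventually_mono[OF eventually_ge_at_top[of T]]) force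
    then show ?thesis by blast
  qed
qed

text \<open>By the mean value theorem \<open>W\<close> grows at least at the linear rate \<eta>, so
  it cannot stay negative.\<close>

lemma not_eventually_neg_if_deriv_ge:
  fixes W W' :: "real \<Rightarrow> real"
  assumes deriv: "\<forall>\<^sub>F t in at_top. (W has_real_derivative W' t) (at t)"
    and ge: "\<forall>\<^sub>F t in at_top. W' t \<ge> \<eta>" and "\<eta> > 0"
    and neg: "\<forall>\<^sub>F t in at_top. W t < 0"
  shows False
proof -
  obtain T where T: "\<And>t. t \<ge> T \<Longrightarrow> (W has_real_derivative W' t) (at t)"
      "\<And>t. t \<ge> T \<Longrightarrow> W' t \<ge> \<eta>" "\<And>t. t \<ge> T \<Longrightarrow> W t < 0"
    using eventually_conj[OF deriv eventually_conj[OF ge neg]]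
    unfolding eventually_at_top_linorder by metis
  \<comment> \<open>The time at which the line of slope \<eta> through \<open>(T, W T)\<close>
    reaches height 1.\<close>
  define b where "b = T + (1 - W T) / \<eta>"
  have b: "b > T" using T(3)[of T] \<open>\<eta> > 0\<close> by (simp add: b_def)
  obtain z where z: "T < z" "z < b" "W b - W T = (b - T) * W' z"
    using MVT2[OF b, of W W'] T(1) by auto
  have "(b - T) * W' z \<ge> (b - T) * \<eta>"
    using z b T(2)[of z] by (intro mult_left_mono) auto
  also have "(b - T) * \<eta> = 1 - W T"
    using \<open>\<eta> > 0\<close> by (simp add: b_def)
  finally show False using z T(3)[of b] b by auto
qed

lemma eventually_at_right_0_scale:
  assumes "\<forall>\<^sub>F u in at_right 0. P u" "c > (0::real)"
  shows "\<forall>\<^sub>F u in at_right 0. P (c * u)"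
proof -
  have "filterlim (\<lambda>u. c * u) (at_right 0) (at_right 0)"
    using assms(2)
    by (intro tendsto_imp_filterlim_at_right)
       (auto intro!: tendsto_eq_intros eventually_mono[OF eventually_at_right_less[of 0]])
  then show ?thesis using assms(1) by (rule eventually_compose_filterlim[rotated])
qed

section \<open>The nonlinearity, the function \<open>F_of f\<close> and its inverse\<close>

text \<open>The limit conditions appear as multiplicative inequalities near the origin, free of
  quotients and extended reals. The local Lipschitz condition appears as continuity together with a
  linear bound at the origin.\<close>

locale superlinear_at_zero =
  fixes f :: "real \<Rightarrow> real"
  assumes f_cont: "continuous_on UNIV f"
    and f_mono: "mono f"
    and f_odd: "\<And>u. f (- u) = - f u"
    and f_pos: "\<And>u. u > 0 \<Longrightarrow> f u > 0"
    and f_linear_bound: "\<exists>L>0. \<exists>\<delta>>0. \<forall>u\<in>{0<..<\<delta>}. f u \<le> L * u"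
    and f_upper: "\<And>\<mu>. \<mu> \<in> {0<..<1} \<Longrightarrow> \<exists>k>0. k < \<mu> \<and> (\<forall>\<^sub>F u in at_right 0. f (\<mu> * u) \<le> k * f u)"
    and f_lower: "\<And>\<eta>. \<eta> < 1 \<Longrightarrow> \<exists>\<epsilon>\<in>{0<..<1}. \<forall>\<^sub>F u in at_right 0. \<eta> * f u \<le> f ((1 - \<epsilon>) * u)"
begin

abbreviation "y \<equiv> F_inv f"

lemma F_has_deriv:
  assumes "x > 0"
  shows "(F_of f has_real_derivative - (1 / f x)) (at x)"
proof -
  \<comment> \<open>The interval \<open>{a..b}\<close> has both \<open>x\<close> and the base point
    1 in its interior and stays away from the singularity of \<open>1 / f\<close> at 0.\<close>
  define a b where "a = min x 1 / 2" and "b = max x 1 + 1"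
  have ab: "0 < a" "a < x" "x < b" "a < 1" "1 < b"
    using assms by (auto simp: a_def b_def min_def max_def)
  have "((\<lambda>u. LBINT v=ereal 1..ereal u. 1 / f v) has_vector_derivative 1 / f x) (at x within {a..b})"
  proof (rule interval_integral_FTC2)
    show "continuous_on {a..b} (\<lambda>v. 1 / f v)"
    proof (intro continuous_intros continuous_on_subset[OF f_cont] ballI)
      fix v assume "v \<in> {a..b}"
      then show "f v \<noteq> 0" using ab f_pos[of v] by simp
    qed simp
  qed (use ab in auto)
  then have "((\<lambda>u. LBINT v=ereal 1..ereal u. 1 / f v) has_real_derivative 1 / f x) (at x)"
    using ab by (simp add: has_real_derivative_iff_has_vector_derivative at_within_Icc_at)
  then have "((\<lambda>u. - (LBINT v=ereal 1..ereal u. 1 / f v)) has_real_derivative - (1 / f x)) (at x)"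
    by (rule DERIV_minus)
  moreover have "F_of f = (\<lambda>u. - (LBINT v=ereal 1..ereal u. 1 / f v))"
    unfolding F_of_def by (rule ext, rule interval_integral_endpoints_reverse)
  ultimately show ?thesis by simp
qed

lemma F_one: "F_of f 1 = 0"
  by (simp add: F_of_def)

lemma F_strict_decreasing:
  assumes "0 < a" "a < b"
  shows "F_of f b < F_of f a"
proof (rule DERIV_neg_imp_decreasing[OF assms(2)])
  fix u assume "a \<le> u" "u \<le> b"
  then show "\<exists>d. DERIV (F_of f) u :> d \<and> d < 0"
    using assms F_has_deriv[of u] f_pos[of u] by (intro exI[of _ "- (1 / f u)"]) auto
qed

lemma F_less_iff: "0 < a \<Longrightarrow> 0 < b \<Longrightarrow> F_of f b < F_of f a \<longleftrightarrow> a < b"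
  using F_strict_decreasing[of a b] F_strict_decreasing[of b a] by (cases a b rule: linorder_cases) auto

lemma F_inj: "inj_on (F_of f) {0<..}"
proof (rule inj_onI)
  fix a b assume "a \<in> {0<..}" "b \<in> {0<..}" "F_of f a = F_of f b"
  then show "a = b"
    using F_less_iff[of a b] F_less_iff[of b a] by auto
qed

lemma F_cont: "S \<subseteq> {0<..} \<Longrightarrow> continuous_on S (F_of f)"
  by (rule DERIV_continuous_on, rule has_field_derivative_at_within, rule F_has_deriv) auto

text \<open>The comparison \<open>f u \<le> L u\<close> makes \<open>F + ln / L\<close> decreasing near the origin.\<close>

lemma F_unbounded: "\<exists>a>0. a \<le> 1 \<and> F_of f a \<ge> t"
proof -
  obtain L \<delta> where L: "L > 0" "\<delta> > 0" "\<And>u. u \<in> {0<..<\<delta>} \<Longrightarrow> f u \<le> L * u"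
    using f_linear_bound by blast
  define b where "b = min (\<delta> / 2) 1"
  have b: "0 < b" "b < \<delta>" "b \<le> 1" using L by (auto simp: b_def)
  \<comment> \<open>The exponential solves \<open>F_of f b + ln b / L = t + ln a / L\<close> for
    \<open>a\<close>; the minimum keeps \<open>a\<close> at most \<open>b\<close>.\<close>
  define a where "a = min b (exp (ln b - L * (t - F_of f b)))"
  have a: "a > 0" "a \<le> b" using b by (auto simp: a_def)
  have "F_of f b + ln b / L \<le> F_of f a + ln a / L"
  proof (rule DERIV_nonpos_imp_nonincreasing[OF a(2)])
    fix u assume u: "a \<le> u" "u \<le> b"
    then have "u > 0" "f u \<le> L * u" "f u > 0" using a b L(3)[of u] f_pos[of u] by auto
    then show "\<exists>d. ((\<lambda>u. F_of f u + ln u / L) has_real_derivative d) (at u) \<and> d \<le> 0"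
      using L by (intro exI[of _ "- (1 / f u) + 1 / u / L"] conjI)
        (auto intro!: derivative_eq_intros F_has_deriv simp: field_simps)
  qed
  moreover have "ln a \<le> ln (exp (ln b - L * (t - F_of f b)))"
    using a(1) by (subst ln_le_cancel_iff) (auto simp: a_def)
  then have "ln a / L \<le> ln b / L - (t - F_of f b)"
    using L by (simp add: field_simps)
  ultimately show ?thesis using a b by (intro exI[of _ a]) auto
qed

text \<open>Since \<open>F_of f 1 = 0\<close> and \<open>F_of f\<close> is unbounded near 0, the
  intermediate value theorem puts every \<open>t \<ge> 0\<close> in the image of the positive axis,
  so \<open>inv_into\<close> gives a true preimage there.\<close>

lemma
  assumes "t \<ge> 0"
  shows y_pos: "y t > 0" and F_y: "F_of f (y t) = t"
proof -
  obtain a where a: "a > 0" "a \<le> 1" "F_of f a \<ge> t" using F_unbounded by blast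
  obtain c where "a \<le> c" "c \<le> 1" "F_of f c = t"
    using IVT2'[of "F_of f" 1 t a] a assms F_one F_cont[of "{a..1}"] by force
  then have "t \<in> F_of f ` {0<..}" using a by force
  then show "y t > 0" "F_of f (y t) = t"
    using inv_into_into[of t "F_of f" "{0<..}"] f_inv_into_f[of t "F_of f" "{0<..}"]
    by (simp_all add: F_inv_def)
qed

lemma y_F: "a > 0 \<Longrightarrow> y (F_of f a) = a"
  unfolding F_inv_def by (rule inv_into_f_f[OF F_inj]) auto

lemma y_has_deriv:
  assumes "t > 0"
  shows "(y has_real_derivative - f (y t)) (at t)"
proof -
  have pos: "y t > 0" and F: "F_of f (y t) = t" using y_pos F_y assms by auto
  have "(y has_derivative (\<lambda>h. - f (y t) * h)) (at (F_of f (y t)))"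
  \<comment> \<open>Inverse function theorem: the slope \<open>- (1 / f (y t))\<close> of
    \<open>F_of f\<close> has reciprocal \<open>- f (y t)\<close>.\<close>
  proof (rule has_derivative_inverse_strong[where S = "{0<..}" and f = "F_of f" and x = "y t"
        and f' = "\<lambda>h. - (1 / f (y t)) * h"])
    show "(F_of f has_derivative (\<lambda>h. - (1 / f (y t)) * h)) (at (y t))"
      using F_has_deriv[OF pos] unfolding has_field_derivative_def .
    show "(\<lambda>h. - (1 / f (y t)) * h) \<circ> (\<lambda>h. - f (y t) * h) = id"
      using f_pos[OF pos] by auto
    show "continuous_on {0<..} (F_of f)" by (rule F_cont) simp
    show "y (F_of f u) = u" if "u \<in> {0<..}" for u using y_F that by simp
  qed (use pos in simp_all)
  then show ?thesis unfolding has_field_derivative_def F .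
qed

text \<open>As \<open>F_of f\<close> decreases, \<open>y t < a\<close> as soon as \<open>t\<close>
  exceeds both 0 and \<open>F_of f a\<close>.\<close>

lemma y_tendsto_0: "(y \<longlongrightarrow> 0) at_top"
proof (rule order_tendstoI)
  fix a :: real assume "a < 0"
  then show "\<forall>\<^sub>F t in at_top. a < y t"
    using y_pos by (intro eventually_mono[OF eventually_ge_at_top[of 0]]) force
next
  fix a :: real assume a: "0 < a"
  show "\<forall>\<^sub>F t in at_top. y t < a"
  proof (rule eventually_mono[OF eventually_gt_at_top[of "max 0 (F_of f a)"]])
    fix t assume "max 0 (F_of f a) < t"
    then show "y t < a" using y_pos[of t] F_y[of t] F_less_iff[of "y t" a] a by auto
  qed
qed

lemma eventually_y_pos: "\<forall>\<^sub>F t in at_top. y t > 0"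
  using y_pos by (intro eventually_mono[OF eventually_ge_at_top[of 0]]) auto

lemma eventually_f_y_pos: "\<forall>\<^sub>F t in at_top. f (y t) > 0"
  using eventually_y_pos by eventually_elim (rule f_pos)

lemma filterlim_y: "filterlim y (at_right 0) at_top"
  using y_tendsto_0 eventually_y_pos by (intro tendsto_imp_filterlim_at_right)

lemma eventually_at_y: "\<forall>\<^sub>F u in at_right 0. P u \<Longrightarrow> \<forall>\<^sub>F t in at_top. P (y t)"
  by (rule eventually_compose_filterlim[OF _ filterlim_y])

section \<open>Asymptotic ratios of \<open>f\<close> along \<open>y\<close>\<close>

text \<open>Shrinking the argument by one factor \<open>1 - \<epsilon>\<close> costs at most a
  factor 1/2 in the value. Iterating until \<open>(1 - \<epsilon>) ^ n < m\<close> and using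
  monotonicity covers every \<open>m > 0\<close>.\<close>

lemma f_scaled_lower:
  assumes "m > 0"
  shows "\<exists>c>0. \<forall>\<^sub>F u in at_right 0. c * f u \<le> f (m * u)"
proof -
  obtain \<epsilon> where e: "\<epsilon> \<in> {0<..<1}" "\<forall>\<^sub>F u in at_right 0. 1/2 * f u \<le> f ((1 - \<epsilon>) * u)"
    using f_lower[of "1/2"] by auto
  have iter: "\<forall>\<^sub>F u in at_right 0. (1/2) ^ n * f u \<le> f ((1 - \<epsilon>) ^ n * u)" for n
  proof (induction n)
    case (Suc n)
    have "\<forall>\<^sub>F u in at_right 0. 1/2 * f ((1 - \<epsilon>) ^ n * u) \<le> f ((1 - \<epsilon>) * ((1 - \<epsilon>) ^ n * u))"
      using e by (intro eventually_at_right_0_scale[OF e(2)]) auto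
    with Suc show ?case by eventually_elim (auto simp: mult_ac)
  qed simp
  obtain n where n: "(1 - \<epsilon>) ^ n < m"
    using real_arch_pow_inv[of m "1 - \<epsilon>"] assms e by auto
  have "\<forall>\<^sub>F u in at_right 0. (1/2) ^ n * f u \<le> f (m * u)"
    using iter[of n] eventually_at_right_less[of 0]
  proof eventually_elim
    case (elim u)
    then have "f ((1 - \<epsilon>) ^ n * u) \<le> f (m * u)"
      using n by (intro monoD[OF f_mono]) auto
    with elim show ?case by simp
  qed
  then show ?thesis by (intro exI[of _ "(1/2)^n"]) auto
qed

text \<open>When \<open>\<bar>x t\<bar> \<le> \<mu> * y t\<close>, monotonicity and oddness bound
  \<open>\<bar>f (x t)\<bar>\<close> by \<open>f (\<mu> * y t)\<close>, and \<open>f_upper\<close>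
  makes this less than \<open>\<mu> * f (y t)\<close>.\<close>

lemma f_ratio_tendsto_0:
  assumes "((\<lambda>t. x t / y t) \<longlongrightarrow> 0) at_top"
  shows "((\<lambda>t. f (x t) / f (y t)) \<longlongrightarrow> 0) at_top"
proof (rule tendstoI)
  fix e :: real assume "e > 0"
  define \<mu> where "\<mu> = min (e/2) (1/2)"
  have mu: "\<mu> \<in> {0<..<1}" "\<mu> < e" using \<open>e > 0\<close> by (auto simp: \<mu>_def)
  obtain k where k: "k > 0" "k < \<mu>" "\<forall>\<^sub>F u in at_right 0. f (\<mu> * u) \<le> k * f u"
    using f_upper[OF mu(1)] by blast
  have "\<forall>\<^sub>F t in at_top. dist (x t / y t) 0 < \<mu>"
    using tendstoD[OF assms, of \<mu>] mu by auto
  then show "\<forall>\<^sub>F t in at_top. dist (f (x t) / f (y t)) 0 < e"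
    using eventually_at_y[OF k(3)] eventually_y_pos eventually_f_y_pos
  proof eventually_elim
    case (elim t)
    then have "x t \<le> \<mu> * y t" "- (\<mu> * y t) \<le> x t"
      by (auto simp: abs_if field_simps split: if_splits)
    then have "f (x t) \<le> f (\<mu> * y t)" "- f (\<mu> * y t) \<le> f (x t)"
      using monoD[OF f_mono] f_odd by metis+
    then have "\<bar>f (x t)\<bar> \<le> k * f (y t)" using elim by auto
    also have "\<dots> < e * f (y t)" using elim k mu by auto
    finally show ?case using elim by (simp add: field_simps)
  qed
qed

text \<open>Both halves rest on \<open>f_lower\<close>: the lower bound uses it at
  \<open>y t\<close>, the upper bound at \<open>y t / (1 - \<epsilon>)\<close>, where it limits how
  much \<open>f\<close> can gain from \<open>y t\<close> to that point.\<close>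

lemma f_ratio_tendsto_1:
  assumes "((\<lambda>t. x t / y t) \<longlongrightarrow> 1) at_top"
  shows "((\<lambda>t. f (x t) / f (y t)) \<longlongrightarrow> 1) at_top"
proof (rule order_tendstoI)
  fix a :: real assume "a < 1"
  then obtain a' where a': "a < a'" "a' < 1" using dense by blast
  obtain \<epsilon> where e: "\<epsilon> \<in> {0<..<1}" "\<forall>\<^sub>F u in at_right 0. a' * f u \<le> f ((1 - \<epsilon>) * u)"
    using f_lower[OF a'(2)] by auto
  have "\<forall>\<^sub>F t in at_top. 1 - \<epsilon> < x t / y t"
    using order_tendstoD(1)[OF assms, of "1 - \<epsilon>"] e by auto
  then show "\<forall>\<^sub>F t in at_top. a < f (x t) / f (y t)"
    using eventually_at_y[OF e(2)] eventually_y_pos eventually_f_y_pos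
  proof eventually_elim
    case (elim t)
    then have "(1 - \<epsilon>) * y t \<le> x t" by (auto simp: field_simps)
    then have "a' * f (y t) \<le> f (x t)" using monoD[OF f_mono] elim by force
    moreover have "a * f (y t) < a' * f (y t)" using elim a' by auto
    ultimately have "a * f (y t) < f (x t)" by linarith
    then show ?case using elim by (simp add: less_divide_eq)
  qed
next
  fix a :: real assume a: "1 < a"
  \<comment> \<open>Chosen so that \<open>1 / \<eta>\<close> is the midpoint of 1 and
    \<open>a\<close>.\<close>
  define \<eta> where "\<eta> = 2 / (1 + a)"
  have eta: "0 < \<eta>" "\<eta> < 1" "1 / \<eta> < a" using a by (auto simp: \<eta>_def)
  obtain \<epsilon> where e: "\<epsilon> \<in> {0<..<1}" "\<forall>\<^sub>F u in at_right 0. \<eta> * f u \<le> f ((1 - \<epsilon>) * u)"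
    using f_lower[OF eta(2)] by auto
  have "\<forall>\<^sub>F t in at_top. x t / y t < 1 / (1 - \<epsilon>)"
    using order_tendstoD(2)[OF assms, of "1 / (1 - \<epsilon>)"] e by auto
  moreover have "\<forall>\<^sub>F u in at_right 0. \<eta> * f (1 / (1 - \<epsilon>) * u) \<le> f ((1 - \<epsilon>) * (1 / (1 - \<epsilon>) * u))"
    using e by (intro eventually_at_right_0_scale[OF e(2)]) auto
  then have "\<forall>\<^sub>F u in at_right 0. \<eta> * f (1 / (1 - \<epsilon>) * u) \<le> f u"
    using e by auto
  then have "\<forall>\<^sub>F t in at_top. \<eta> * f (1 / (1 - \<epsilon>) * y t) \<le> f (y t)"
    by (rule eventually_at_y)
  ultimately show "\<forall>\<^sub>F t in at_top. f (x t) / f (y t) < a"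
    using eventually_y_pos eventually_f_y_pos
  proof eventually_elim
    case (elim t)
    then have "x t \<le> 1 / (1 - \<epsilon>) * y t" by (auto simp: divide_less_eq)
    then have "\<eta> * f (x t) \<le> \<eta> * f (1 / (1 - \<epsilon>) * y t)"
      using monoD[OF f_mono] eta by (intro mult_left_mono) auto
    then have "\<eta> * f (x t) \<le> f (y t)" using elim by linarith
    then have "f (x t) / f (y t) \<le> 1 / \<eta>" using elim eta by (auto simp: field_simps)
    then show ?case using eta by linarith
  qed
qed

text \<open>Serves both directions of the equivalence; the limit -1 reduces to the limit 1 because
  \<open>f\<close> is odd.\<close>

lemma f_ratio_tendsto:
  assumes "\<Lambda> \<in> {-1, 0, 1}" and lim: "((\<lambda>t. x t / y t) \<longlongrightarrow> \<Lambda>) at_top"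
  shows "((\<lambda>t. f (x t) / f (y t)) \<longlongrightarrow> \<Lambda>) at_top"
proof -
  consider "\<Lambda> = -1" | "\<Lambda> = 0" | "\<Lambda> = 1" using assms(1) by auto
  then show ?thesis
  proof cases
    case 1
    have "((\<lambda>t. f (- x t) / f (y t)) \<longlongrightarrow> 1) at_top"
      using tendsto_minus[OF lim] 1 by (intro f_ratio_tendsto_1) simp
    from tendsto_minus[OF this] show ?thesis by (simp add: f_odd 1)
  qed (use f_ratio_tendsto_0 f_ratio_tendsto_1 lim in auto)
qed

end

section \<open>Crossings of the levels \<open>l * y t\<close>\<close>

text \<open>Statement (c) is the assumption \<open>g_small\<close>, so this setting serves the
  implication from (c) to (d).\<close>

locale perturbed_ode = superlinear_at_zero +
  fixes x g :: "real \<Rightarrow> real"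
  assumes x_ode: "\<And>t. t > 0 \<Longrightarrow> (x has_real_derivative (- f (x t) + g t)) (at t)"
    and x_lim: "(x \<longlongrightarrow> 0) at_top"
    and g_small: "((\<lambda>t. g t / f (y t)) \<longlongrightarrow> 0) at_top"
begin

lemma uminus: "perturbed_ode f (\<lambda>t. - x t) (\<lambda>t. - g t)"
proof unfold_locales
  fix t :: real assume "t > 0"
  then show "((\<lambda>t. - x t) has_real_derivative - f (- x t) + - g t) (at t)"
    using DERIV_minus[OF x_ode, of t] by (simp add: f_odd)
qed (use tendsto_minus[OF x_lim] tendsto_minus[OF g_small] in auto)

lemma eventually_g_small:
  assumes "e > 0"
  shows "\<forall>\<^sub>F t in at_top. \<bar>g t\<bar> \<le> e * f (y t)"
  using tendstoD[OF g_small assms] eventually_f_y_pos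
  by eventually_elim (auto simp: field_simps)

lemma eventually_at_x:
  assumes "\<forall>\<^sub>F u in at_right 0. P u" "\<forall>\<^sub>F t in at_top. x t > 0"
  shows "\<forall>\<^sub>F t in at_top. P (x t)"
  using tendsto_imp_filterlim_at_right[OF x_lim assms(2)] assms(1)
  by (rule eventually_compose_filterlim[rotated])

lemma x_minus_level_has_deriv:
  "\<forall>\<^sub>F t in at_top. ((\<lambda>t. x t - l * y t) has_real_derivative (- f (x t) + g t + l * f (y t))) (at t)"
proof (rule eventually_mono[OF eventually_gt_at_top[of 0]])
  fix t :: real assume "t > 0"
  then show "((\<lambda>t. x t - l * y t) has_real_derivative (- f (x t) + g t + l * f (y t))) (at t)"
    by (auto intro!: derivative_eq_intros x_ode y_has_deriv)
qed

text \<open>At a late crossing \<open>x t = l * y t\<close> the derivative of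
  \<open>x t - l * y t\<close> is at least \<open>(l - k) * f (y t) + g t\<close>, which is positive
  as \<open>g\<close> uses up at most half of the gap.\<close>

lemma level_below_1:
  assumes "l \<in> {0<..<1}"
  shows "(\<forall>\<^sub>F t in at_top. x t > l * y t) \<or> (\<forall>\<^sub>F t in at_top. x t < l * y t)"
proof -
  obtain k where k: "k > 0" "k < l" "\<forall>\<^sub>F u in at_right 0. f (l * u) \<le> k * f u"
    using f_upper[OF assms] by blast
  have "(l - k) / 2 > 0" using k by simp
  from eventually_at_y[OF k(3)] eventually_g_small[OF this] eventually_f_y_pos
  have "\<forall>\<^sub>F t in at_top. x t - l * y t = 0 \<longrightarrow> - f (x t) + g t + l * f (y t) > 0"
  proof eventually_elim
    case (elim t)
    have "(l - k) / 2 * f (y t) < l * f (y t) - k * f (y t)"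
      using k elim by (simp flip: left_diff_distrib)
    then have "- f (l * y t) + g t + l * f (y t) > 0" using elim by linarith
    then show ?case by auto
  qed
  from eventually_sign_if_deriv_pos_at_zeros[OF x_minus_level_has_deriv this]
  show ?thesis by simp
qed

text \<open>Late crossings now go downwards: \<open>f (l * y t)\<close> is at least
  \<open>f (y t) / k\<close> with \<open>1 / k > l\<close>, so the sign lemma is applied to
  \<open>- (x t - l * y t)\<close>.\<close>

lemma level_above_1:
  assumes "l > 1"
  shows "(\<forall>\<^sub>F t in at_top. x t > l * y t) \<or> (\<forall>\<^sub>F t in at_top. x t < l * y t)"
proof -
  obtain k where k: "k > 0" "k < 1 / l" "\<forall>\<^sub>F u in at_right 0. f (1 / l * u) \<le> k * f u"
    using f_upper[of "1 / l"] assms by auto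
  \<comment> \<open>As \<open>f_upper\<close> concerns factors below 1, it is used with factor
    \<open>1 / l\<close> at the point \<open>l * u\<close>.\<close>
  have "\<forall>\<^sub>F u in at_right 0. f (1 / l * (l * u)) \<le> k * f (l * u)"
    using assms by (intro eventually_at_right_0_scale[OF k(3)]) auto
  then have "\<forall>\<^sub>F u in at_right 0. f u \<le> k * f (l * u)" using assms by simp
  then have ev: "\<forall>\<^sub>F t in at_top. f (y t) \<le> k * f (l * y t)" by (rule eventually_at_y)
  \<comment> \<open>The gap in \<open>f (l * y t) - l * f (y t) \<ge> d * f (y t)\<close>; half of
    it absorbs \<open>g\<close>.\<close>
  define d where "d = 1 / k - l"
  have d: "d > 0" using k assms by (simp add: d_def field_simps)
  then have "d / 2 > 0" by simp
  from ev eventually_g_small[OF this] eventually_f_y_pos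
  have "\<forall>\<^sub>F t in at_top. - (x t - l * y t) = 0 \<longrightarrow> - (- f (x t) + g t + l * f (y t)) > 0"
  proof eventually_elim
    case (elim t)
    have "(d + l) * f (y t) \<le> f (l * y t)" using k elim by (simp add: d_def field_simps)
    then have "d * f (y t) + l * f (y t) \<le> f (l * y t)" by (simp add: distrib_right)
    moreover have "d / 2 * f (y t) < d * f (y t)" using d elim by simp
    ultimately have "- (- f (l * y t) + g t + l * f (y t)) > 0" using elim by linarith
    then show ?case by auto
  qed
  moreover have "\<forall>\<^sub>F t in at_top. ((\<lambda>t. - (x t - l * y t)) has_real_derivative
      - (- f (x t) + g t + l * f (y t))) (at t)"
    using x_minus_level_has_deriv[of l] by eventually_elim (rule DERIV_minus)
  ultimately show ?thesis
    using eventually_sign_if_deriv_pos_at_zeros[of "\<lambda>t. - (x t - l * y t)"] by fastforce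
qed

section \<open>Excluding persistent positions by comparing \<open>F_of f (x t / l)\<close> with
  \<open>t\<close>\<close>

text \<open>Because \<open>F_of f (y t) = t\<close>, the sign of this difference tells on which side
  of \<open>l * y t\<close> the solution lies; its derivative comes from the chain rule and the
  equation.\<close>

lemma F_x_has_deriv:
  assumes "\<forall>\<^sub>F t in at_top. x t > 0" "l > 0"
  shows "\<forall>\<^sub>F t in at_top. ((\<lambda>t. F_of f (x t / l) - t) has_real_derivative
           (f (x t) - g t) / (l * f (x t / l)) - 1) (at t)"
  using assms(1) eventually_gt_at_top[of 0]
proof eventually_elim
  case (elim t)
  then have "x t / l > 0" using assms by simp
  have "((\<lambda>t. x t / l) has_real_derivative (- f (x t) + g t) / l) (at t)"
    using elim by (intro DERIV_cdivide x_ode)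
  from DERIV_chain2[OF F_has_deriv[OF \<open>x t / l > 0\<close>] this]
  have "((\<lambda>t. F_of f (x t / l)) has_real_derivative (f (x t) - g t) / (l * f (x t / l))) (at t)"
    by (rule DERIV_cong) (use assms(2) f_pos[OF \<open>x t / l > 0\<close>] in \<open>simp add: field_simps\<close>)
  then show ?case by (intro derivative_intros)
qed

text \<open>Above the level, \<open>F_of f (x t / l) - t\<close> is negative. Yet
  \<open>f (x t / l) \<le> k * f (x t)\<close> with \<open>k * l < 1\<close>, and \<open>g\<close>
  is small against \<open>f (x t) \<ge> f (y t)\<close>, so the difference grows at least
  linearly.\<close>

lemma not_eventually_above:
  assumes "l > 1"
  shows "\<not> (\<forall>\<^sub>F t in at_top. x t > l * y t)"
proof
  assume above: "\<forall>\<^sub>F t in at_top. x t > l * y t"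
  have pos: "\<forall>\<^sub>F t in at_top. x t > 0"
    using above eventually_y_pos
    by eventually_elim (use assms in \<open>smt (verit) mult_pos_pos\<close>)
  obtain k where k: "k > 0" "k < 1 / l" "\<forall>\<^sub>F u in at_right 0. f (1 / l * u) \<le> k * f u"
    using f_upper[of "1 / l"] assms by auto
  have kl: "k * l < 1" using k assms by (simp add: field_simps)
  \<comment> \<open>Half of the slack in \<open>k * l < 1\<close>, which gives
    \<open>(1 - e) / (k * l) = 1 + e / (k * l)\<close>.\<close>
  define e where "e = (1 - k * l) / 2"
  have "e > 0" using kl by (simp add: e_def)
  have "\<forall>\<^sub>F t in at_top. (f (x t) - g t) / (l * f (x t / l)) - 1 \<ge> e / (k * l)"
    using eventually_at_x[OF k(3) pos] eventually_g_small[OF \<open>e > 0\<close>] above pos eventually_y_pos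
  proof eventually_elim
    case (elim t)
    have fp: "f (x t / l) > 0" "f (x t) > 0" using elim assms by (auto intro!: f_pos)
    have "y t \<le> l * y t" using assms elim by auto
    then have "f (y t) \<le> f (x t)" using elim by (intro monoD[OF f_mono]) linarith
    then have "e * f (y t) \<le> e * f (x t)" using \<open>e > 0\<close> by (intro mult_left_mono) auto
    then have num: "(1 - e) * f (x t) \<le> f (x t) - g t" using elim by (auto simp: algebra_simps)
    have "1 + e / (k * l) = (1 - e) / (k * l)"
      using k assms by (simp add: e_def field_simps)
    also have "\<dots> = (1 - e) * f (x t) / (l * (k * f (x t)))"
      using fp by simp
    also have "\<dots> \<le> (f (x t) - g t) / (l * f (x t / l))"
    proof (rule frac_le)
      have "k * l > 0" using k assms by simp
      then have "e \<le> 1" by (simp add: e_def)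
      then have "(1 - e) * f (x t) \<ge> 0" using fp by simp
      then show "f (x t) - g t \<ge> 0" using num by linarith
    qed (use num fp assms elim in auto)
    finally show ?case by simp
  qed
  moreover have "\<forall>\<^sub>F t in at_top. F_of f (x t / l) - t < 0"
    using above pos eventually_ge_at_top[of 0]
  proof eventually_elim
    case (elim t)
    then have "y t < x t / l" "x t / l > 0" using assms by (auto simp: field_simps)
    then show ?case using F_less_iff[of "y t" "x t / l"] y_pos[of t] F_y[of t] elim by auto
  qed
  moreover have "e / (k * l) > 0" using \<open>e > 0\<close> k assms by auto
  ultimately show False
    using not_eventually_neg_if_deriv_ge[OF F_x_has_deriv[OF pos, of l]] assms by auto
qed

text \<open>Below the level, \<open>F_of f (x t / l) - t\<close> is positive, while
  \<open>f (x t) \<le> k * f (x t / l)\<close> with \<open>k < l\<close> makes it decrease at least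
  linearly. The barrier \<open>m * y t\<close> serves to make \<open>g\<close> small against
  \<open>f (x t)\<close>.\<close>

lemma not_eventually_between:
  assumes "m > 0" "l \<in> {0<..<1}"
    and above: "\<forall>\<^sub>F t in at_top. x t > m * y t" and below: "\<forall>\<^sub>F t in at_top. x t < l * y t"
  shows False
proof -
  have pos: "\<forall>\<^sub>F t in at_top. x t > 0"
    using above eventually_y_pos
    by eventually_elim (use assms in \<open>smt (verit) mult_pos_pos\<close>)
  obtain k where k: "k > 0" "k < l" "\<forall>\<^sub>F u in at_right 0. f (l * u) \<le> k * f u"
    using f_upper[of l] assms by auto
  have k': "\<forall>\<^sub>F u in at_right 0. f (l * (1 / l * u)) \<le> k * f (1 / l * u)"
    using assms by (intro eventually_at_right_0_scale[OF k(3)]) auto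
  \<comment> \<open>Through \<open>x t > m * y t\<close> this gives
    \<open>c * f (y t) \<le> f (x t)\<close>, so the bound \<open>e * c * f (y t)\<close> on
    \<open>g\<close> becomes \<open>e * f (x t)\<close>.\<close>
  obtain c where c: "c > 0" "\<forall>\<^sub>F u in at_right 0. c * f u \<le> f (m * u)"
    using f_scaled_lower[OF \<open>m > 0\<close>] by blast
  \<comment> \<open>Chosen so that \<open>(1 + e) * k\<close> is the midpoint of \<open>k\<close>
    and \<open>l\<close>.\<close>
  define e where "e = (l - k) / (2 * k)"
  have "e > 0" using k by (simp add: e_def)
  then have "e * c > 0" using c by simp
  have "\<forall>\<^sub>F t in at_top. - ((f (x t) - g t) / (l * f (x t / l)) - 1) \<ge> (l - k) / (2 * l)"
    using eventually_at_x[OF k' pos] eventually_g_small[OF \<open>e * c > 0\<close>] eventually_at_y[OF c(2)]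
      above pos
  proof eventually_elim
    case (elim t)
    have fp: "f (x t / l) > 0" "f (x t) > 0" using elim assms by (auto intro!: f_pos)
    have "f (m * y t) \<le> f (x t)" using elim by (intro monoD[OF f_mono]) auto
    then have "e * (c * f (y t)) \<le> e * f (x t)"
      using \<open>e > 0\<close> elim by (intro mult_left_mono) auto
    then have "f (x t) - g t \<le> (1 + e) * f (x t)" using elim by (auto simp: algebra_simps)
    also have "\<dots> \<le> (1 + e) * (k * f (x t / l))"
      using elim \<open>e > 0\<close> assms by (intro mult_left_mono) auto
    also have "\<dots> = (l + k) / 2 * f (x t / l)"
      using k by (simp add: e_def field_simps)
    finally have "(f (x t) - g t) / (l * f (x t / l)) \<le> (l + k) / 2 * f (x t / l) / (l * f (x t / l))"
      using fp assms by (intro divide_right_mono) auto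
    also have "\<dots> = (l + k) / (2 * l)" using fp by simp
    also have "\<dots> = 1 - (l - k) / (2 * l)" using assms by (simp add: field_simps)
    finally show ?case by simp
  qed
  moreover have "\<forall>\<^sub>F t in at_top. - (F_of f (x t / l) - t) < 0"
    using below pos eventually_ge_at_top[of 0]
  proof eventually_elim
    case (elim t)
    then have "x t / l < y t" "x t / l > 0" using assms by (auto simp: field_simps)
    then show ?case using F_less_iff[of "x t / l" "y t"] y_pos[of t] F_y[of t] elim by auto
  qed
  moreover have "\<forall>\<^sub>F t in at_top. ((\<lambda>t. - (F_of f (x t / l) - t)) has_real_derivative
           - ((f (x t) - g t) / (l * f (x t / l)) - 1)) (at t)"
    using assms(2) by (intro eventually_mono[OF F_x_has_deriv[OF pos, of l]] DERIV_minus) auto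
  moreover have "(l - k) / (2 * l) > 0" using k assms by auto
  ultimately show False
    by (intro not_eventually_neg_if_deriv_ge[where W = "\<lambda>t. - (F_of f (x t / l) - t)"])
qed

section \<open>The possible limits of \<open>x t / y t\<close>\<close>

lemma eventually_below_above_1:
  assumes "l > 1"
  shows "\<forall>\<^sub>F t in at_top. x t / y t < l"
proof -
  have "\<forall>\<^sub>F t in at_top. x t < l * y t"
    using level_above_1[OF assms] not_eventually_above[OF assms] by blast
  then show ?thesis using eventually_y_pos by eventually_elim (auto simp: field_simps)
qed

text \<open>If \<open>x\<close> eventually stays above some \<open>m * y t\<close> with
  \<open>0 < m < 1\<close>, it cannot remain below any level in \<open>(0, 1)\<close>, so it ends
  above all of them and the limit is 1. Otherwise the dichotomy at each such level puts it
  below.\<close>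

lemma tendsto_1_or_eventually_below:
  "((\<lambda>t. x t / y t) \<longlongrightarrow> 1) at_top \<or> (\<forall>l>0. \<forall>\<^sub>F t in at_top. x t / y t < l)"
proof (cases "\<exists>m\<in>{0<..<1}. \<forall>\<^sub>F t in at_top. x t > m * y t")
  case True
  then obtain m where m: "m > 0" "\<forall>\<^sub>F t in at_top. x t > m * y t" by auto
  have "((\<lambda>t. x t / y t) \<longlongrightarrow> 1) at_top"
  proof (rule order_tendstoI)
    fix a :: real assume "a < 1"
    \<comment> \<open>Replaces \<open>a\<close>, which may be nonpositive, by a level in
      \<open>(0, 1)\<close>.\<close>
    define l where "l = max a (1/2)"
    have l: "l \<in> {0<..<1}" "a \<le> l" using \<open>a < 1\<close> by (auto simp: l_def)
    have "\<forall>\<^sub>F t in at_top. x t > l * y t"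
      using level_below_1[OF l(1)] not_eventually_between[OF m(1) l(1) m(2)] by blast
    then show "\<forall>\<^sub>F t in at_top. a < x t / y t"
      using eventually_y_pos
    proof eventually_elim
      case (elim t)
      then have "l < x t / y t" by (auto simp: field_simps)
      with l show ?case by simp
    qed
  qed (rule eventually_below_above_1)
  then show ?thesis ..
next
  case False
  have "\<forall>\<^sub>F t in at_top. x t / y t < l" if "l > 0" for l
  proof -
    define l' where "l' = min l (1/2)"
    have l': "l' \<in> {0<..<1}" "l' \<le> l" using that by (auto simp: l'_def)
    have "\<forall>\<^sub>F t in at_top. x t < l' * y t" using level_below_1[OF l'(1)] False l' by blast
    then show ?thesis using eventually_y_pos
    proof eventually_elim
      case (elim t)
      then have "x t / y t < l'" by (auto simp: field_simps)
      with l' show ?case by simp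
    qed
  qed
  then show ?thesis by blast
qed

text \<open>The preceding alternative is applied to \<open>x\<close> and to \<open>- x\<close>. If
  neither ratio tends to 1, both are eventually below every positive level, so the limit is
  0.\<close>

lemma tendsto_trichotomy:
  "\<exists>\<Lambda>\<in>{-1, 0, 1}. ((\<lambda>t. x t / y t) \<longlongrightarrow> \<Lambda>) at_top"
proof -
  interpret neg: perturbed_ode f "\<lambda>t. - x t" "\<lambda>t. - g t" by (rule uminus)
  consider "((\<lambda>t. x t / y t) \<longlongrightarrow> 1) at_top" | "((\<lambda>t. - x t / y t) \<longlongrightarrow> 1) at_top"
    | "\<And>l. l > 0 \<Longrightarrow> \<forall>\<^sub>F t in at_top. x t / y t < l"
      "\<And>l. l > 0 \<Longrightarrow> \<forall>\<^sub>F t in at_top. - x t / y t < l"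
    using tendsto_1_or_eventually_below neg.tendsto_1_or_eventually_below by blast
  then show ?thesis
  proof cases
    case 2
    from tendsto_minus[OF this] show ?thesis by simp
  next
    case 3
    have "((\<lambda>t. x t / y t) \<longlongrightarrow> 0) at_top"
    proof (rule order_tendstoI)
      fix a :: real assume "a < 0"
      then show "\<forall>\<^sub>F t in at_top. a < x t / y t"
        using 3(2)[of "- a"] by simp
    qed (rule 3(1))
    then show ?thesis by blast
  qed auto
qed

end

section \<open>The equivalence of (c) and (d)\<close>

theorem theorem3:
  fixes f g x :: "real \<Rightarrow> real" and \<xi> :: real
  assumes f_lipschitz: "local_lipschitz (UNIV :: real set) UNIV (\<lambda>_. f)"
    and f_increasing: "mono f"
    and f_odd: "\<And>u. f (- u) = - f u"
    and f_zero: "f 0 = 0"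
    and f_sign: "\<And>u. u \<noteq> 0 \<Longrightarrow> u * f u > 0"
    and f_lower: "\<exists>\<epsilon>\<^sub>0\<in>{0<..<1}. (\<forall>\<epsilon>\<in>{0<..<\<epsilon>\<^sub>0}. lower_Phi f \<epsilon> > 0) \<and>
                    (lower_Phi f \<longlongrightarrow> 1) (at_right 0)"
    and f_upper: "\<And>\<mu>. \<mu> \<in> {0<..<1} \<Longrightarrow>
                    Limsup (at_right 0) (\<lambda>u. ereal (f (\<mu> * u) / f u)) < ereal \<mu>"
    and g_cont: "continuous_on {0..} g"
    and x_cont: "continuous_on {0..} x"
    and x_ode: "\<And>t. t > 0 \<Longrightarrow> (x has_real_derivative (- f (x t) + g t)) (at t)"
    and x_init: "x 0 = \<xi>"
    and x_lim: "(x \<longlongrightarrow> 0) at_top"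
  shows "((\<lambda>t. g t / f (F_inv f t)) \<longlongrightarrow> 0) at_top \<longleftrightarrow>
         (\<exists>\<Lambda>\<in>{-1, 0, 1 :: real}.
            ((\<lambda>t. x t / F_inv f t) \<longlongrightarrow> \<Lambda>) at_top \<and>
            ((\<lambda>t. deriv x t / f (F_inv f t)) \<longlongrightarrow> - \<Lambda>) at_top)"
proof -
  have f_pos: "f u > 0" if "u > 0" for u
    using f_sign[of u] that by (simp add: zero_less_mult_iff)
  interpret superlinear_at_zero f
  proof
    show "continuous_on UNIV f"
      using local_lipschitz_continuous_on[OF f_lipschitz, of "0"] by simp
    obtain \<delta> L where L: "\<delta> > 0" "L-lipschitz_on (cball 0 \<delta>) f"
      using local_lipschitzE[OF f_lipschitz, of 0 0] by (metis Int_UNIV_right UNIV_I centre_in_cball less_imp_le)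
    show "\<exists>L>0. \<exists>\<delta>>0. \<forall>u\<in>{0<..<\<delta>}. f u \<le> L * u"
    proof (intro exI conjI ballI)
      \<comment> \<open>A Lipschitz constant is only known to be nonnegative; adding 1 makes it
        positive.\<close>
      show "L + 1 > 0" using lipschitz_on_nonneg[OF L(2)] by simp
      fix u assume u: "u \<in> {0<..<\<delta>}"
      then have "f u \<le> L * u" using lipschitz_onD[OF L(2), of u 0] f_zero by (auto simp: dist_real_def)
      then show "f u \<le> (L + 1) * u" using u by (simp add: algebra_simps)
    qed (rule L(1))
  next
    fix \<mu> :: real assume mu: "\<mu> \<in> {0<..<1}"
    obtain k where k: "Limsup (at_right 0) (\<lambda>u. ereal (f (\<mu> * u) / f u)) < ereal k" "k < \<mu>"
      using ereal_dense2[OF f_upper[OF mu]] by auto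
    \<comment> \<open>The maximum yields positivity at once and stays below \<mu>.\<close>
    define k' where "k' = max k (\<mu> / 2)"
    have k': "k' > 0" "k' < \<mu>" "k \<le> k'" using k mu by (auto simp: k'_def)
    have "\<forall>\<^sub>F u in at_right 0. f (\<mu> * u) \<le> k' * f u"
      using Limsup_lessD[OF k(1)] eventually_at_right_less[of 0]
    proof eventually_elim
      case (elim u)
      then have "f (\<mu> * u) \<le> k * f u" using f_pos[of u] by (auto simp: field_simps)
      also have "\<dots> \<le> k' * f u" using k' f_pos[of u] elim by (intro mult_right_mono) auto
      finally show ?case .
    qed
    with k' show "\<exists>k>0. k < \<mu> \<and> (\<forall>\<^sub>F u in at_right 0. f (\<mu> * u) \<le> k * f u)" by blast
  next
    fix \<eta> :: real assume eta: "\<eta> < 1"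
    have "\<forall>\<^sub>F \<epsilon> in at_right 0. lower_Phi f \<epsilon> > ereal \<eta>"
      using f_lower eta by (intro order_tendstoD(1)[of _ 1]) auto
    moreover have "\<forall>\<^sub>F \<epsilon> in at_right 0. \<epsilon> \<in> {0<..<(1::real)}"
      by (rule eventually_at_right_real) simp
    ultimately have "\<forall>\<^sub>F \<epsilon> in at_right 0. \<epsilon> \<in> {0<..<1} \<and> lower_Phi f \<epsilon> > ereal \<eta>"
      by eventually_elim simp
    then obtain \<epsilon> where e: "\<epsilon> \<in> {0<..<1}" "lower_Phi f \<epsilon> > ereal \<eta>"
      using eventually_happens'[OF trivial_limit_at_right_real] by blast
    have "\<forall>\<^sub>F u in at_right 0. \<eta> * f u \<le> f ((1 - \<epsilon>) * u)"
      using less_LiminfD[OF e(2)[unfolded lower_Phi_def]] eventually_at_right_less[of 0]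
      by eventually_elim (use f_pos in \<open>force simp: field_simps\<close>)
    with e show "\<exists>\<epsilon>\<in>{0<..<1}. \<forall>\<^sub>F u in at_right 0. \<eta> * f u \<le> f ((1 - \<epsilon>) * u)" by blast
  qed (use f_increasing f_odd f_pos in auto)
  have deriv: "\<forall>\<^sub>F t in at_top. deriv x t = - f (x t) + g t"
    using x_ode by (intro eventually_mono[OF eventually_gt_at_top[of 0]]) (auto intro: DERIV_imp_deriv)
  show ?thesis
  proof
    assume g_small: "((\<lambda>t. g t / f (F_inv f t)) \<longlongrightarrow> 0) at_top"
    then interpret perturbed_ode f x g
      by unfold_locales (use x_ode x_lim in auto)
    obtain \<Lambda> where L: "\<Lambda> \<in> {-1, 0, 1}" "((\<lambda>t. x t / y t) \<longlongrightarrow> \<Lambda>) at_top"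
      using tendsto_trichotomy by blast
    \<comment> \<open>By the equation this sum is eventually
      \<open>deriv x t / f (y t)\<close>.\<close>
    have "((\<lambda>t. - (f (x t) / f (y t)) + g t / f (y t)) \<longlongrightarrow> - \<Lambda> + 0) at_top"
      by (intro tendsto_intros f_ratio_tendsto L g_small)
    moreover have "\<forall>\<^sub>F t in at_top. - (f (x t) / f (y t)) + g t / f (y t) = deriv x t / f (y t)"
      using deriv by eventually_elim (simp add: add_divide_distrib diff_divide_distrib)
    ultimately have "((\<lambda>t. deriv x t / f (y t)) \<longlongrightarrow> - \<Lambda>) at_top"
      by (simp add: tendsto_cong)
    with L show "\<exists>\<Lambda>\<in>{-1, 0, 1 :: real}. ((\<lambda>t. x t / y t) \<longlongrightarrow> \<Lambda>) at_top \<and>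
        ((\<lambda>t. deriv x t / f (y t)) \<longlongrightarrow> - \<Lambda>) at_top" by blast
  next
    assume "\<exists>\<Lambda>\<in>{-1, 0, 1 :: real}. ((\<lambda>t. x t / y t) \<longlongrightarrow> \<Lambda>) at_top \<and>
        ((\<lambda>t. deriv x t / f (y t)) \<longlongrightarrow> - \<Lambda>) at_top"
    then obtain \<Lambda> where L: "\<Lambda> \<in> {-1, 0, 1}" "((\<lambda>t. x t / y t) \<longlongrightarrow> \<Lambda>) at_top"
      "((\<lambda>t. deriv x t / f (y t)) \<longlongrightarrow> - \<Lambda>) at_top" by blast
    \<comment> \<open>The equation solved for \<open>g\<close>: the two limits cancel.\<close>
    have "((\<lambda>t. deriv x t / f (y t) + f (x t) / f (y t)) \<longlongrightarrow> - \<Lambda> + \<Lambda>) at_top"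
      by (intro tendsto_intros f_ratio_tendsto L)
    moreover have "\<forall>\<^sub>F t in at_top. deriv x t / f (y t) + f (x t) / f (y t) = g t / f (y t)"
      using deriv by eventually_elim (simp add: add_divide_distrib diff_divide_distrib)
    ultimately show "((\<lambda>t. g t / f (y t)) \<longlongrightarrow> 0) at_top"
      by (simp add: tendsto_cong)
  qed
qed

end
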